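(* Let $C$ be a topological space. Let $h(\cdot,\cdot)=(h_1(\cdot,\cdot),h_2(\cdot,\cdot)):\mathbb{R}^2\times C\to\mathbb{R}^2$ be a single-valued mapping and let $\omega=(\omega_1,\omega_2):C\to\mathbb{R}^2$ be a single-valued lower semicontinuous mapping. Let $f:\mathbb{R}^2\to\mathbb{R}^2$ be defined by $f(x_1,x_2)=\left(\frac{x_1^2-x_2^2}{\sqrt{x_1^2+x_2^2}},\frac{2x_1x_2}{\sqrt{x_1^2+x_2^2}}\right)$ for $(x_1,x_2)\in\mathbb{R}^2\setminus\{\theta\}$, with $f(\theta)=\theta$. Let $\bar x=(\bar x_1,\bar x_2)$ and $\bar y$ be in $\mathbb{R}^2\setminus\{\theta\}$ with $\bar y=f(\bar x)$, and let $\bar s\in C$. Suppose that there is a number $\beta\in[0,1)$ such that the mapping $h(\cdot,s):\mathbb{R}^2\to\mathbb{R}^2$ satisfies the Lipschitz condition on $\mathbb{R}^2$ for each $s\in C$ with the uniform modulus $\beta$, and the mapping $s\mapsto h(\bar x,s)$ is lower semicontinuous at $\bar s$. Then for each $\alpha>0$ with $\beta<\alpha<1$, there exist a neighborhood $W\subset C$ of $\bar s$ and a single-valued mapping $\sigma=(\sigma_1,\sigma_2):W\to\mathbb{R}^2$ such that whenever $s\in W$ we have $$\begin{cases}\dfrac{\sigma_1(s)^2-\sigma_2(s)^2}{\sqrt{\sigma_1(s)^2+\sigma_2(s)^2}}=h_1\big((\sigma_1(s),\sigma_2(s)),s\big)+\omega_1(s),\\[2mm] \dfrac{2\sigma_1(s)\sigma_2(s)}{\sqrt{\sigma_1(s)^2+\sigma_2(s)^2}}=h_2\big((\sigma_1(s),\sigma_2(s)),s\big)+\omega_2(s),\end{cases}$$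 and $$\|(\sigma_1(s),\sigma_2(s))-(\bar x_1,\bar x_2)\|\le\frac{\left\|h((\bar x_1,\bar x_2),s)+(\omega_1(s),\omega_2(s))-\left(\frac{\bar x_1^2-\bar x_2^2}{\sqrt{\bar x_1^2+\bar x_2^2}},\frac{2\bar x_1\bar x_2}{\sqrt{\bar x_1^2+\bar x_2^2}}\right)\right\|}{\alpha-\beta}.$$ In particular, $\sigma$ satisfies, whenever $s\in W$, $$\Big(h_1\big((\sigma_1(s),\sigma_2(s)),s\big)+\omega_1(s)\Big)^2+\Big(h_2\big((\sigma_1(s),\sigma_2(s)),s\big)+\omega_2(s)\Big)^2=\sigma_1(s)^2+\sigma_2(s)^2.$$
   Context: $\theta$ denotes the origin of $\mathbb{R}^2$ and $\|\cdot\|$ is the Euclidean norm. The left-hand sides of the system are the components of $f(\sigma(s))$, so when $\sigma(s)=\theta$ they are understood to be $0$ (since $f(\theta)=\theta$). A single-valued mapping into $\mathbb{R}^2$ is regarded as a set-valued mapping with singleton values; lower semicontinuity is the lower (inner) semicontinuity of set-valued mappings: $\Phi:C\rightrightarrows\mathbb{R}^2$ is lower semicontinuous at $\bar s$ if for every open $V$ with $V\cap\Phi(\bar s)\ne\emptyset$ there is a neighborhood $N$ of $\bar s$ with $V\cap\Phi(s)\neq\emptyset$ for all $s\in N$ (for singleton values this is continuity at $\bar s$). *)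

theory Defs
  imports "HOL-Analysis.Analysis"
begin

definition lsc_at :: "('a::topological_space \<Rightarrow> 'b::topological_space set) \<Rightarrow> 'a \<Rightarrow> bool" where
  "lsc_at \<Phi> s0 \<longleftrightarrow>
     (\<forall>V. open V \<and> V \<inter> \<Phi> s0 \<noteq> {} \<longrightarrow>
        (\<exists>N. s0 \<in> interior N \<and> (\<forall>s\<in>N. V \<inter> \<Phi> s \<noteq> {})))"

definition lsc :: "('a::topological_space \<Rightarrow> 'b::topological_space set) \<Rightarrow> bool" where
  "lsc \<Phi> \<longleftrightarrow> (\<forall>s. lsc_at \<Phi> s)"

definition f_map :: "real^2 \<Rightarrow> real^2" where
  "f_map x = (if x = 0 then 0
          else vector [((x$1)\<^sup>2 - (x$2)\<^sup>2) / sqrt ((x$1)\<^sup>2 + (x$2)\<^sup>2),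
                       2 * x$1 * x$2 / sqrt ((x$1)\<^sup>2 + (x$2)\<^sup>2)])"

end

theory Submission
  imports Defs
begin

text \<open>
  In complex notation \<open>f z = z\<^sup>2 / \<bar>z\<bar>\<close>: it preserves norms and doubles angles. Both \<open>z\<close> and \<open>- z\<close>
  are preimages of \<open>f z\<close>, and the one at an angle of at most \<open>\<pi> / 2\<close> from \<open>x\<close> satisfies
  \<open>\<bar>z - x\<bar> \<le> \<bar>f z - f x\<bar>\<close>, so \<open>f\<close> is metrically regular on the whole plane with modulus 1.
  The iteration \<open>f x\<^bsub>n+1\<^esub> = h(x\<^bsub>n\<^esub>, s) + \<omega> s\<close> of Lyusternik and Graves, started at \<open>xbar\<close>, then converges
  geometrically with ratio \<open>\<beta>\<close> to a solution within
  \<open>\<bar>h(xbar, s) + \<omega> s - f xbar\<bar> / (1 - \<beta>)\<close> of \<open>xbar\<close>. Nothing here is local in \<open>s\<close>, so \<open>W\<close> can be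
  the whole space.
\<close>

text \<open>Covering lets \<open>f x' = g x\<close> be solved for \<open>x'\<close> near
  \<open>x\<close>. The chosen solution map \<open>N\<close> need not be a contraction, but
  successive steps along one orbit shrink by the factor \<open>\<beta>\<close>; completeness yields
  a limit, and continuity of \<open>f\<close> and \<open>g\<close> makes it a coincidence
  point.\<close>

lemma coincidence_of_covering_and_contraction:
  fixes f g :: "'a::complete_space \<Rightarrow> 'b::metric_space"
  assumes cont: "continuous_on UNIV f"
    and cover: "\<And>x y. \<exists>z. f z = y \<and> dist z x \<le> dist y (f x)"
    and lip: "\<beta>-lipschitz_on UNIV g" and "\<beta> < 1"
  obtains x where "f x = g x" "dist x x0 \<le> dist (g x0) (f x0) / (1 - \<beta>)"
proof -
  have \<beta>: "0 \<le> \<beta>" using lip by (rule lipschitz_on_nonneg)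
  obtain N where N: "\<And>x. f (N x) = g x" "\<And>x. dist (N x) x \<le> dist (g x) (f x)"
  proof -
    have "\<forall>x. \<exists>z. f z = g x \<and> dist z x \<le> dist (g x) (f x)" using cover by blast
    then show thesis using that by metis
  qed
  define X where "X n = (N ^^ n) x0" for n
  have X0: "X 0 = x0" and XS: "X (Suc n) = N (X n)" for n by (simp_all add: X_def)
  define d where "d = dist (g x0) (f x0)"
  have step: "dist (X (Suc n)) (X n) \<le> d * \<beta> ^ n" for n
  proof (induction n)
    case 0
    then show ?case using N(2)[of x0] by (simp add: XS X0 d_def)
  next
    case (Suc n)
    \<comment> \<open>Since \<open>f (X (Suc n)) = g (X n)\<close>, the residual bounding the next
      step is a difference of two values of \<open>g\<close>.\<close>
    have "dist (X (Suc (Suc n))) (X (Suc n)) \<le> dist (g (X (Suc n))) (g (X n))"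
      using N(2)[of "X (Suc n)"] N(1)[of "X n"] by (simp add: XS)
    also have "\<dots> \<le> \<beta> * dist (X (Suc n)) (X n)"
      using lip by (rule lipschitz_onD) auto
    also have "\<dots> \<le> \<beta> * (d * \<beta> ^ n)" using Suc \<beta> by (rule mult_left_mono)
    finally show ?case by (simp add: ac_simps)
  qed
  \<comment> \<open>Uniformity in \<open>k\<close> serves twice: large \<open>n\<close> gives the
    Cauchy property, and \<open>n = 0\<close> gives the final distance estimate in the
    limit.\<close>
  have dist_le: "dist (X (n + k)) (X n) \<le> d * \<beta> ^ n / (1 - \<beta>)" for n k
  proof -
    have "dist (X (n + k)) (X n) \<le> d * \<beta> ^ n * (\<Sum>i<k. \<beta> ^ i)"
    proof (induction k)
      case (Suc k)
      have "dist (X (n + Suc k)) (X n) \<le> dist (X (Suc (n + k))) (X (n + k)) + dist (X (n + k)) (X n)"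
        using dist_triangle by simp
      also have "\<dots> \<le> d * \<beta> ^ (n + k) + d * \<beta> ^ n * (\<Sum>i<k. \<beta> ^ i)"
        using step Suc by (rule add_mono)
      finally show ?case by (simp add: algebra_simps power_add)
    qed simp
    also have "(\<Sum>i<k. \<beta> ^ i) \<le> 1 / (1 - \<beta>)"
      using \<open>\<beta> < 1\<close> \<beta> by (simp add: sum_gp_strict divide_right_mono)
    then have "d * \<beta> ^ n * (\<Sum>i<k. \<beta> ^ i) \<le> d * \<beta> ^ n * (1 / (1 - \<beta>))"
      by (rule mult_left_mono) (simp add: d_def \<beta>)
    finally show ?thesis by simp
  qed
  have "Cauchy X"
  proof (rule metric_CauchyI)
    fix e :: real assume "e > 0"
    have "(\<lambda>n. d * \<beta> ^ n / (1 - \<beta>)) \<longlonglongrightarrow> d * 0 / (1 - \<beta>)"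
      using \<beta> \<open>\<beta> < 1\<close> by (intro tendsto_intros LIMSEQ_realpow_zero) auto
    then have "eventually (\<lambda>n. d * \<beta> ^ n / (1 - \<beta>) < e / 2) sequentially"
      using \<open>e > 0\<close> by (intro order_tendstoD(2)) auto
    then obtain M where M: "d * \<beta> ^ M / (1 - \<beta>) < e / 2"
      by (auto simp: eventually_sequentially)
    have "dist (X m) (X M) < e / 2" if "m \<ge> M" for m
      using le_less_trans[OF dist_le[of M "m - M"] M] that by simp
    then show "\<exists>M. \<forall>m\<ge>M. \<forall>n\<ge>M. dist (X m) (X n) < e"
      by (metis dist_triangle_half_l dist_commute)
  qed
  then obtain x where x: "X \<longlonglongrightarrow> x"
    using Cauchy_convergent convergent_def by blast
  show thesis
  proof
    have "(\<lambda>n. f (X (Suc n))) \<longlonglongrightarrow> f x"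
      using continuous_on_tendsto_compose[OF cont LIMSEQ_Suc[OF x]] by simp
    moreover have "(\<lambda>n. g (X n)) \<longlonglongrightarrow> g x"
      using continuous_on_tendsto_compose[OF lipschitz_on_continuous_on[OF lip] x] by simp
    ultimately show "f x = g x"
      using LIMSEQ_unique by (simp add: XS N(1))
    have "(\<lambda>n. dist (X n) x0) \<longlonglongrightarrow> dist x x0"
      using x by (intro tendsto_intros)
    then show "dist x x0 \<le> dist (g x0) (f x0) / (1 - \<beta>)"
      using dist_le[of 0] by (intro LIMSEQ_le_const2) (auto simp: X0 d_def)
  qed
qed

lemma norm_real2: "norm (x :: real^2) = sqrt ((x$1)\<^sup>2 + (x$2)\<^sup>2)"
  by (simp add: norm_vec_def L2_set_def sum_2)

lemma inner_real2: "(x :: real^2) \<bullet> y = x$1 * y$1 + x$2 * y$2"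
  by (simp add: inner_vec_def sum_2)

text \<open>At the origin these formulas hold because division by 0 yields 0.\<close>

lemma f_map_nth:
  "f_map x $ 1 = ((x$1)\<^sup>2 - (x$2)\<^sup>2) / norm x"
  "f_map x $ 2 = 2 * x$1 * x$2 / norm x"
  by (simp_all add: f_map_def norm_real2 vector_2)

lemma f_map_minus: "f_map (- x) = f_map x"
  by (simp add: vec_eq_iff forall_2 f_map_nth)

text \<open>Angle doubling: if \<open>t\<close> is the angle between nonzero \<open>x\<close> and
  \<open>z\<close>, this is \<open>cos (2 * t) = 2 * (cos t)^2 - 1\<close> scaled by the
  norms.\<close>

lemma f_map_inner:
  "f_map x \<bullet> f_map z = (2 * (x \<bullet> z)\<^sup>2 - (norm x * norm z)\<^sup>2) / (norm x * norm z)"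
proof -
  have "2 * (x \<bullet> z)\<^sup>2 - (norm x * norm z)\<^sup>2 =
      ((x$1)\<^sup>2 - (x$2)\<^sup>2) * ((z$1)\<^sup>2 - (z$2)\<^sup>2) + (2 * x$1 * x$2) * (2 * z$1 * z$2)"
    by (simp add: norm_real2 power_mult_distrib inner_real2) (simp add: algebra_simps power2_eq_square)
  then show ?thesis
    by (simp add: inner_real2[of "f_map x"] f_map_nth add_divide_distrib)
qed

lemma norm_f_map: "norm (f_map x) = norm x"
proof -
  have "(norm (f_map x))\<^sup>2 = (norm x)\<^sup>2"
    using f_map_inner[of x x]
    by (cases "x = 0") (simp_all add: power2_norm_eq_inner[symmetric] dot_square_norm power2_eq_square)
  then show ?thesis by simp
qed

lemma continuous_on_f_map: "continuous_on UNIV f_map"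
proof -
  have "isCont f_map x" for x
  proof (cases "x = 0")
    case True
    \<comment> \<open>The quotient rule fails at the origin; norm preservation gives the limit
      instead.\<close>
    have "(f_map \<longlongrightarrow> 0) (at 0)"
      by (rule tendsto_norm_zero_cancel) (simp add: norm_f_map tendsto_norm_zero)
    then show ?thesis using True by (simp add: isCont_def f_map_def)
  next
    case False
    then have "((\<lambda>y. f_map y $ 1) \<longlongrightarrow> f_map x $ 1) (at x)" "((\<lambda>y. f_map y $ 2) \<longlongrightarrow> f_map x $ 2) (at x)"
      unfolding f_map_nth by (auto intro!: tendsto_intros)
    then have "((\<lambda>y. f_map y $ i) \<longlongrightarrow> f_map x $ i) (at x)" for i
      using exhaust_2[of i] by metis
    then show ?thesis by (simp add: isCont_def vec_tendstoI)
  qed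
  then show ?thesis by (simp add: continuous_on_eq_continuous_at)
qed

lemma surj_f_map: "\<exists>z. f_map z = y"
proof -
  define w where "w = Complex (y$1) (y$2)"
  \<comment> \<open>To get \<open>u^2 / cmod u = w\<close>, a square root of \<open>w\<close> is
    rescaled so that \<open>cmod u = cmod w\<close>.\<close>
  define u where "u = of_real (sqrt (cmod w)) * csqrt w"
  define z :: "real^2" where "z = vector [Re u, Im u]"
  have nz: "norm z = cmod w"
    by (simp add: z_def norm_real2 vector_2 flip: cmod_def) (simp add: u_def norm_mult)
  have "u\<^sup>2 = of_real (cmod w) * w"
    by (simp add: u_def power_mult_distrib flip: of_real_power)
  then have "(Re u)\<^sup>2 - (Im u)\<^sup>2 = cmod w * y$1" "2 * Re u * Im u = cmod w * y$2"
    by (simp_all add: complex_eq_iff w_def Re_power2 Im_power2)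
  moreover have "y = 0" if "w = 0"
    using that by (simp add: w_def complex_eq_iff vec_eq_iff forall_2)
  ultimately have "f_map z = y"
    using nz by (cases "w = 0") (auto simp: vec_eq_iff forall_2 f_map_nth z_def vector_2)
  then show ?thesis ..
qed

text \<open>With \<open>c = x \<bullet> z\<close> and \<open>p = norm x * norm z\<close> this says \<open>(2 * c\<^sup>2 - p\<^sup>2) / p \<le> c\<close>,
  that is \<open>(2 * c + p) * (c - p) \<le> 0\<close>.\<close>

lemma f_map_inner_le:
  assumes "0 \<le> x \<bullet> z"
  shows "f_map x \<bullet> f_map z \<le> x \<bullet> z"
proof (cases "x = 0 \<or> z = 0")
  case True
  then show ?thesis by (auto simp: f_map_def)
next
  case False
  define c p where "c = x \<bullet> z" and "p = norm x * norm z"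
  have "p > 0" using False by (simp add: p_def)
  have "c \<le> p" by (simp add: c_def p_def norm_cauchy_schwarz)
  have "(2 * c + p) * (c - p) \<le> 0"
    using assms \<open>p > 0\<close> \<open>c \<le> p\<close> by (intro mult_nonneg_nonpos) (auto simp: c_def)
  then have "(2 * c\<^sup>2 - p\<^sup>2) / p \<le> c"
    using \<open>p > 0\<close> by (simp add: divide_le_eq algebra_simps power2_eq_square)
  then show ?thesis by (simp add: f_map_inner c_def p_def)
qed

text \<open>As \<open>f_map\<close> preserves norms, expanding both squared distances leaves only a
  comparison of inner products, which holds once the sign of the preimage is chosen to make
  \<open>z \<bullet> x\<close> nonnegative.\<close>

lemma f_map_covering: "\<exists>z. f_map z = y \<and> dist z x \<le> dist y (f_map x)"
proof -
  obtain z0 where "f_map z0 = y" using surj_f_map by blast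
  then obtain z where z: "f_map z = y" "0 \<le> z \<bullet> x"
    by (metis f_map_minus inner_minus_left linear neg_0_le_iff_le)
  have "(norm (z - x))\<^sup>2 \<le> (norm (f_map z - f_map x))\<^sup>2"
    using f_map_inner_le[OF z(2)]
    by (simp add: dot_norm_neg norm_f_map field_simps)
  then have "dist z x \<le> dist y (f_map x)"
    by (simp add: z(1) dist_norm)
  with z(1) show ?thesis by blast
qed

theorem theorem8p2:
  fixes h :: "(real^2) \<times> ('c::topological_space) \<Rightarrow> real^2"
    and \<omega> :: "'c \<Rightarrow> real^2"
    and xbar ybar :: "real^2"
    and sbar :: 'c
    and \<beta> :: real
  assumes "lsc (\<lambda>s. {\<omega> s})"
    and "xbar \<noteq> 0" and "ybar \<noteq> 0" and "ybar = f_map xbar"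
    and "0 \<le> \<beta>" and "\<beta> < 1"
    and "\<And>s. \<beta>-lipschitz_on UNIV (\<lambda>x. h (x, s))"
    and "lsc_at (\<lambda>s. {h (xbar, s)}) sbar"
  shows "\<forall>\<alpha>::real. 0 < \<alpha> \<and> \<beta> < \<alpha> \<and> \<alpha> < 1 \<longrightarrow>
    (\<exists>(W :: 'c set) (\<sigma> :: 'c \<Rightarrow> real^2). sbar \<in> interior W \<and>
      (\<forall>s\<in>W.
        f_map (\<sigma> s) $ 1 = h (\<sigma> s, s) $ 1 + \<omega> s $ 1 \<and>
        f_map (\<sigma> s) $ 2 = h (\<sigma> s, s) $ 2 + \<omega> s $ 2 \<and>
        norm (\<sigma> s - xbar) \<le> norm (h (xbar, s) + \<omega> s - f_map xbar) / (\<alpha> - \<beta>) \<and>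
        (h (\<sigma> s, s) $ 1 + \<omega> s $ 1)\<^sup>2 + (h (\<sigma> s, s) $ 2 + \<omega> s $ 2)\<^sup>2
          = (\<sigma> s $ 1)\<^sup>2 + (\<sigma> s $ 2)\<^sup>2))"
proof (intro allI impI)
  fix \<alpha> :: real assume \<alpha>: "0 < \<alpha> \<and> \<beta> < \<alpha> \<and> \<alpha> < 1"
  have "\<exists>x. f_map x = h (x, s) + \<omega> s \<and>
      norm (x - xbar) \<le> norm (h (xbar, s) + \<omega> s - f_map xbar) / (\<alpha> - \<beta>)" for s
  proof -
    have "\<beta>-lipschitz_on UNIV (\<lambda>x. h (x, s) + \<omega> s)"
      using assms(7)[of s] by (simp add: lipschitz_on_def)
    then obtain x where x: "f_map x = h (x, s) + \<omega> s"
        "dist x xbar \<le> dist (h (xbar, s) + \<omega> s) (f_map xbar) / (1 - \<beta>)"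
      using coincidence_of_covering_and_contraction
        [OF continuous_on_f_map f_map_covering _ \<open>\<beta> < 1\<close>] by blast
    note x(2)
    \<comment> \<open>The iteration gives the constant for \<open>\<alpha> = 1\<close>; a smaller
      \<open>\<alpha>\<close> only weakens the bound.\<close>
    also have "dist (h (xbar, s) + \<omega> s) (f_map xbar) / (1 - \<beta>) \<le>
        dist (h (xbar, s) + \<omega> s) (f_map xbar) / (\<alpha> - \<beta>)"
      using \<alpha> by (intro divide_left_mono) auto
    finally show ?thesis using x(1) by (auto simp: dist_norm)
  qed
  then obtain \<sigma> where \<sigma>: "\<And>s. f_map (\<sigma> s) = h (\<sigma> s, s) + \<omega> s"
      "\<And>s. norm (\<sigma> s - xbar) \<le> norm (h (xbar, s) + \<omega> s - f_map xbar) / (\<alpha> - \<beta>)"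
    by metis
  \<comment> \<open>This is norm preservation of \<open>f_map\<close>, read through the equation
    solved by \<open>\<sigma> s\<close>.\<close>
  have "(h (\<sigma> s, s) $ 1 + \<omega> s $ 1)\<^sup>2 + (h (\<sigma> s, s) $ 2 + \<omega> s $ 2)\<^sup>2
      = (\<sigma> s $ 1)\<^sup>2 + (\<sigma> s $ 2)\<^sup>2" for s
    using norm_f_map[of "\<sigma> s"] by (simp add: \<sigma>(1) norm_real2)
  then show "\<exists>(W :: 'c set) (\<sigma> :: 'c \<Rightarrow> real^2). sbar \<in> interior W \<and>
      (\<forall>s\<in>W.
        f_map (\<sigma> s) $ 1 = h (\<sigma> s, s) $ 1 + \<omega> s $ 1 \<and>
        f_map (\<sigma> s) $ 2 = h (\<sigma> s, s) $ 2 + \<omega> s $ 2 \<and>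
        norm (\<sigma> s - xbar) \<le> norm (h (xbar, s) + \<omega> s - f_map xbar) / (\<alpha> - \<beta>) \<and>
        (h (\<sigma> s, s) $ 1 + \<omega> s $ 1)\<^sup>2 + (h (\<sigma> s, s) $ 2 + \<omega> s $ 2)\<^sup>2
          = (\<sigma> s $ 1)\<^sup>2 + (\<sigma> s $ 2)\<^sup>2)"
    using \<sigma> by (intro exI[of _ UNIV] exI[of _ \<sigma>]) simp
qed

end
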